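(* Assume the Slater condition: there exists $\hat x\in\mathbb{R}^n$ with $f_i(\hat x)<0$ for all $i=1,\dots,m$. Let $\{x^k\}$ be the sequence generated by PACA (the algorithm described in the context) starting from an arbitrary point $x^0\in\mathbb{R}^n$. If $\{x^k\}$ is infinite, then $\{x^k\}$ converges R-linearly to some point $x^\star\in C$.
   Context: Setting. $m,n\ge 1$; $f_i:\mathbb{R}^n\to\mathbb{R}$ is convex for $i=1,\dots,m$; $C_i=\{x\in\mathbb{R}^n: f_i(x)\le 0\}$ and $C=\bigcap_{i=1}^m C_i$. $\|\cdot\|$ is the Euclidean norm and $\partial f_i(x)$ is the convex subdifferential. $\{\epsilon_k\}_{k\ge 0}$ is a decreasing sequence of positive reals ($\epsilon_{k+1}<\epsilon_k$) converging to $0$. PACA (Perturbed Approximate Circumcenter Algorithm). Start from $x^0\in\mathbb{R}^n$. Given $x^k$: if $x^k\in C$, stop. Otherwise choose arbitrary $u_i^k\in\partial f_i(x^k)$ for $i=1,\dots,m$, and set $$v_i^k=\frac{\max\{0,f_i(x^k)+\epsilon_k\}}{\|u_i^k\|^2}\,u_i^k,\qquad w^k=\frac1m\sum_{i=1}^m v_i^k .$$ If $w^k=0$, put $x^{k+1}=x^k$ and go to iteration $k+1$. Otherwise put $$\alpha_k=\frac{\frac1m\sum_{i=1}^m\|v_i^k\|^2}{\|w^k\|^2},\qquad x^{k+1}=x^k-\alpha_k w^k .$$ Here $v_i^k=0$ whenever $f_i(x^k)+\epsilon_k\le 0$, and it is understood that the iterates are well defined, i.e. $u_i^k\ne 0$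 whenever $f_i(x^k)+\epsilon_k>0$. The sequence is called infinite if the algorithm never stops, i.e. $x^k\notin C$ for all $k$. A sequence $\{y^k\}$ converges R-linearly to $y^\star$ if $\limsup_{k\to\infty}\|y^k-y^\star\|^{1/k}<1$. *)

theory Defs
  imports "HOL-Analysis.Analysis"
begin

definition subdifferential :: "('a::real_inner \<Rightarrow> real) \<Rightarrow> 'a \<Rightarrow> 'a set" where
  "subdifferential g x = {u. \<forall>y. g x + u \<bullet> (y - x) \<le> g y}"

text \<open>A family of \<open>m\<close> functions is given as \<open>f :: nat \<Rightarrow> 'a \<Rightarrow> real\<close>, of which only the
  members with index in \<open>{1..m}\<close> matter.\<close>

definition feasible_set :: "nat \<Rightarrow> (nat \<Rightarrow> 'a \<Rightarrow> real) \<Rightarrow> 'a set" where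
  "feasible_set m f = (\<Inter>i\<in>{1..m}. {x. f i x \<le> 0})"

definition slater :: "nat \<Rightarrow> (nat \<Rightarrow> 'a \<Rightarrow> real) \<Rightarrow> bool" where
  "slater m f \<longleftrightarrow> (\<exists>z. \<forall>i\<in>{1..m}. f i z < 0)"

text \<open>In the next three definitions \<open>e\<close> is the current perturbation, \<open>x\<close> the current iterate
  and \<open>u i\<close> the subgradient chosen for \<open>f i\<close> at \<open>x\<close>.\<close>

definition paca_v :: "(nat \<Rightarrow> 'a::real_inner \<Rightarrow> real) \<Rightarrow> real \<Rightarrow> 'a \<Rightarrow> (nat \<Rightarrow> 'a) \<Rightarrow> nat \<Rightarrow> 'a" where
  "paca_v f e x u i = (max 0 (f i x + e) / (norm (u i))\<^sup>2) *\<^sub>R u i"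

definition paca_w :: "nat \<Rightarrow> (nat \<Rightarrow> 'a::real_inner \<Rightarrow> real) \<Rightarrow> real \<Rightarrow> 'a \<Rightarrow> (nat \<Rightarrow> 'a) \<Rightarrow> 'a" where
  "paca_w m f e x u = (1 / real m) *\<^sub>R (\<Sum>i=1..m. paca_v f e x u i)"

definition paca_alpha ::
    "nat \<Rightarrow> (nat \<Rightarrow> 'a::real_inner \<Rightarrow> real) \<Rightarrow> real \<Rightarrow> 'a \<Rightarrow> (nat \<Rightarrow> 'a) \<Rightarrow> real" where
  "paca_alpha m f e x u =
     ((1 / real m) * (\<Sum>i=1..m. (norm (paca_v f e x u i))\<^sup>2)) / (norm (paca_w m f e x u))\<^sup>2"

definition paca_next ::
    "nat \<Rightarrow> (nat \<Rightarrow> 'a::real_inner \<Rightarrow> real) \<Rightarrow> real \<Rightarrow> 'a \<Rightarrow> (nat \<Rightarrow> 'a) \<Rightarrow> 'a" where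
  "paca_next m f e x u =
     (if paca_w m f e x u = 0 then x
      else x - paca_alpha m f e x u *\<^sub>R paca_w m f e x u)"

text \<open>A run of PACA from \<open>x0\<close>, where \<open>u k i\<close> is the subgradient chosen for \<open>f i\<close> at iteration \<open>k\<close>.
  A run that stops is represented by a sequence that is constant from the stopping index on.
  The requirement \<open>u k i \<noteq> 0\<close> is the standing assumption that the iterates are well defined.\<close>

definition paca_run ::
    "nat \<Rightarrow> (nat \<Rightarrow> 'a::real_inner \<Rightarrow> real) \<Rightarrow> (nat \<Rightarrow> real) \<Rightarrow> 'a \<Rightarrow> (nat \<Rightarrow> 'a) \<Rightarrow> (nat \<Rightarrow> nat \<Rightarrow> 'a) \<Rightarrow> bool"
  where
  "paca_run m f \<epsilon> x0 x u \<longleftrightarrow>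
     x 0 = x0 \<and>
     (\<forall>k. if x k \<in> feasible_set m f then x (Suc k) = x k
          else (\<forall>i\<in>{1..m}. u k i \<in> subdifferential (f i) (x k) \<and>
                           (f i (x k) + \<epsilon> k > 0 \<longrightarrow> u k i \<noteq> 0)) \<and>
               x (Suc k) = paca_next m f (\<epsilon> k) (x k) (u k))"

definition paca_infinite :: "nat \<Rightarrow> (nat \<Rightarrow> 'a \<Rightarrow> real) \<Rightarrow> (nat \<Rightarrow> 'a) \<Rightarrow> bool" where
  "paca_infinite m f x \<longleftrightarrow> (\<forall>k. x k \<notin> feasible_set m f)"

text \<open>The limit superior is taken in the extended reals, so that it always exists.\<close>

definition R_linearly_converges :: "(nat \<Rightarrow> 'a::real_normed_vector) \<Rightarrow> 'a \<Rightarrow> bool" where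
  "R_linearly_converges y l \<longleftrightarrow> limsup (\<lambda>k. ereal (root k (norm (y k - l)))) < 1"

end

theory Submission
  imports Defs
begin

text \<open>
  Write \<open>D e\<close> for the perturbed set of the points at which every \<open>f i + e\<close> is nonpositive. The
  vector \<open>v i\<close> is the displacement of the iterate from its projection onto a half-space that
  contains \<open>D e\<close>, and the step length of the algorithm is long enough for the step to decrease the
  squared distance to every point of \<open>D e\<close> by at least the mean \<open>Q\<close> of the
  \<open>(norm (v i))\<^sup>2\<close> (\<open>paca_next_fejer\<close>).

  The Slater condition makes \<open>D (\<epsilon> k)\<close> nonempty once \<open>\<epsilon> k\<close> is small, and from then on it gives
  an error bound: moving a little from an iterate towards a
  Slater point reaches \<open>D e\<close>, so the distance of the iterate to \<open>D e\<close> is at most a constant times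
  its largest violation (\<open>slater_error_bound\<close>). On a bounded set the subgradients are bounded, so
  the violation is in turn bounded by a multiple of \<open>sqrt Q\<close>. Hence the distance to the current
  perturbed set shrinks by a fixed factor in one step (\<open>infdist_paca_next_contracts\<close>). The sets
  \<open>D (\<epsilon> k)\<close> grow with \<open>k\<close>, so that passing to the next one only decreases the distance; this is
  why the speed at which \<open>\<epsilon>\<close> tends to \<open>0\<close> does not matter.

  Finally, the later iterates come no farther from the point of \<open>D (\<epsilon> k)\<close> nearest to \<open>x k\<close>, so
  they all lie within twice the distance of \<open>x k\<close> to \<open>D (\<epsilon> k)\<close>. Geometric decay of that distance
  therefore gives convergence of the iterates with the same rate (\<open>fejer_geometric_convergence\<close>).
\<close>

section \<open>One step of the algorithm\<close>

definition perturbed_set :: "nat \<Rightarrow> (nat \<Rightarrow> 'a \<Rightarrow> real) \<Rightarrow> real \<Rightarrow> 'a set" where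
  "perturbed_set m f e = {y. \<forall>i\<in>{1..m}. f i y + e \<le> 0}"

lemma perturbed_set_antimono: "e' \<le> e \<Longrightarrow> perturbed_set m f e \<subseteq> perturbed_set m f e'"
  unfolding perturbed_set_def by force

lemma feasible_set_eq_perturbed_set: "feasible_set m f = perturbed_set m f 0"
  unfolding feasible_set_def perturbed_set_def by auto

lemma closed_perturbed_set:
  fixes f :: "nat \<Rightarrow> 'a::topological_space \<Rightarrow> real"
  assumes "\<And>i. i \<in> {1..m} \<Longrightarrow> continuous_on UNIV (f i)"
  shows "closed (perturbed_set m f e)"
proof -
  have "closed {y. f i y + e \<le> 0}" if "i \<in> {1..m}" for i
    using assms[OF that] by (intro closed_Collect_le continuous_intros)
  moreover have "perturbed_set m f e = (\<Inter>i\<in>{1..m}. {y. f i y + e \<le> 0})"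
    by (auto simp: perturbed_set_def)
  ultimately show ?thesis by auto
qed

definition paca_mean_sq ::
    "nat \<Rightarrow> (nat \<Rightarrow> 'a::real_inner \<Rightarrow> real) \<Rightarrow> real \<Rightarrow> 'a \<Rightarrow> (nat \<Rightarrow> 'a) \<Rightarrow> real" where
  "paca_mean_sq m f e x u = (1 / real m) * (\<Sum>i=1..m. (norm (paca_v f e x u i))\<^sup>2)"

lemma paca_mean_sq_nonneg: "0 \<le> paca_mean_sq m f e x u"
  unfolding paca_mean_sq_def by (simp add: sum_nonneg)

lemma norm_paca_v_le_mean_sq:
  assumes "i \<in> {1..m}"
  shows "(norm (paca_v f e x u i))\<^sup>2 \<le> real m * paca_mean_sq m f e x u"
proof -
  have "(norm (paca_v f e x u i))\<^sup>2 \<le> (\<Sum>i=1..m. (norm (paca_v f e x u i))\<^sup>2)"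
    using assms by (intro member_le_sum) auto
  then show ?thesis
    using assms by (simp add: paca_mean_sq_def)
qed

text \<open>The subgradient inequality puts \<open>s\<close> into a half-space whose point nearest to \<open>x\<close> is
  \<open>x - v i\<close>; the estimate is the obtuse angle property of that projection.\<close>

lemma norm_paca_v_le_inner:
  assumes "u i \<in> subdifferential (f i) x" and "f i s + e \<le> 0"
  shows "(norm (paca_v f e x u i))\<^sup>2 \<le> paca_v f e x u i \<bullet> (x - s)"
proof (cases "f i x + e \<le> 0 \<or> u i = 0")
  case True
  then show ?thesis by (auto simp: paca_v_def)
next
  case False
  define c where "c = (f i x + e) / (norm (u i))\<^sup>2"
  have v: "paca_v f e x u i = c *\<^sub>R u i"
    using False by (simp add: paca_v_def c_def)
  have "c \<ge> 0" using False by (simp add: c_def)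
  have "f i x + u i \<bullet> (s - x) \<le> f i s"
    using assms(1) by (auto simp: subdifferential_def)
  then have *: "f i x + e \<le> u i \<bullet> (x - s)"
    using assms(2) by (simp add: inner_diff_right)
  have "(norm (c *\<^sub>R u i))\<^sup>2 = c * (f i x + e)"
    using False by (simp add: c_def power_mult_distrib power2_eq_square)
  also have "\<dots> \<le> c * (u i \<bullet> (x - s))"
    using * \<open>c \<ge> 0\<close> by (rule mult_left_mono)
  finally show ?thesis by (simp add: v)
qed

lemma norm_paca_w_le_mean_sq: "(norm (paca_w m f e x u))\<^sup>2 \<le> paca_mean_sq m f e x u"
proof (cases "m = 0")
  case True
  then show ?thesis by (simp add: paca_w_def paca_mean_sq_def)
next
  case False
  let ?v = "paca_v f e x u"
  have "(norm (\<Sum>i=1..m. ?v i))\<^sup>2 \<le> (\<Sum>i=1..m. norm (?v i))\<^sup>2"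
    by (intro power_mono norm_sum) auto
  also have "\<dots> \<le> (\<Sum>i=1..m. (norm (?v i))\<^sup>2) * real m"
    using sum_squared_le_sum_of_squares[of "\<lambda>i. norm (?v i)" "{1..m}"] False by simp
  finally show ?thesis
    using False
    by (simp add: paca_w_def paca_mean_sq_def power_mult_distrib field_simps power2_eq_square)
qed

text \<open>With \<open>w = paca_w\<close> and \<open>Q = paca_mean_sq\<close>, averaging the obtuse angle inequalities gives
  \<open>Q \<le> w \<bullet> (x - s)\<close>. The step length \<open>\<alpha>\<close> satisfies \<open>\<alpha> * (norm w)\<^sup>2 = Q\<close>, so the squared distance to
  \<open>s\<close> drops by at least \<open>\<alpha> * Q\<close>, and \<open>\<alpha> \<ge> 1\<close> by convexity of the squared norm. If \<open>w = 0\<close>, the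
  averaged inequality forces \<open>Q = 0\<close>, and not moving is harmless.\<close>

lemma paca_next_fejer:
  assumes "\<And>i. i \<in> {1..m} \<Longrightarrow> u i \<in> subdifferential (f i) x"
    and "s \<in> perturbed_set m f e"
  shows "(norm (paca_next m f e x u - s))\<^sup>2 + paca_mean_sq m f e x u \<le> (norm (x - s))\<^sup>2"
proof -
  let ?v = "paca_v f e x u"
  define w where "w = paca_w m f e x u"
  define Q where "Q = paca_mean_sq m f e x u"
  define \<alpha> where "\<alpha> = Q / (norm w)\<^sup>2"
  have "(\<Sum>i=1..m. (norm (?v i))\<^sup>2) \<le> (\<Sum>i=1..m. ?v i \<bullet> (x - s))"
    using assms by (intro sum_mono norm_paca_v_le_inner) (auto simp: perturbed_set_def)
  then have Q_le: "Q \<le> w \<bullet> (x - s)"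
    unfolding Q_def w_def paca_mean_sq_def paca_w_def
    by (simp add: inner_sum_left divide_right_mono)
  have w_le: "(norm w)\<^sup>2 \<le> Q"
    unfolding w_def Q_def by (rule norm_paca_w_le_mean_sq)
  show ?thesis
  proof (cases "w = 0")
    case True
    then show ?thesis using Q_le by (simp add: paca_next_def flip: w_def Q_def)
  next
    case False
    have \<alpha>w: "\<alpha> * (norm w)\<^sup>2 = Q" using False by (simp add: \<alpha>_def)
    have "\<alpha> \<ge> 1" using False w_le by (simp add: \<alpha>_def)
    have next_eq: "paca_next m f e x u = x - \<alpha> *\<^sub>R w"
      using False
      by (simp add: paca_next_def paca_alpha_def \<alpha>_def Q_def paca_mean_sq_def flip: w_def)
    have "(norm (x - \<alpha> *\<^sub>R w - s))\<^sup>2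
        = (norm (x - s))\<^sup>2 - 2 * \<alpha> * (w \<bullet> (x - s)) + \<alpha> * (\<alpha> * (norm w)\<^sup>2)"
      unfolding power2_norm_eq_inner
      by (simp add: algebra_simps inner_commute)
    moreover have "\<alpha> * Q \<le> \<alpha> * (w \<bullet> (x - s))"
      using Q_le \<open>\<alpha> \<ge> 1\<close> by (intro mult_left_mono) auto
    moreover have "Q \<le> \<alpha> * Q"
      using \<open>\<alpha> \<ge> 1\<close> paca_mean_sq_nonneg[of m f e x u] mult_right_mono[of 1 \<alpha> Q]
      by (simp add: Q_def)
    ultimately show ?thesis
      unfolding next_eq \<alpha>w Q_def[symmetric] by linarith
  qed
qed

section \<open>Error bound and contraction\<close>

text \<open>The point of the segment from \<open>y\<close> to the Slater point \<open>z\<close> at which a convex function that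
  is at most \<open>M\<close> at \<open>y\<close> and at most \<open>-r\<close> at \<open>z\<close> must have become nonpositive has parameter
  \<open>M / (M + r)\<close>, hence lies within \<open>M / r\<close> times \<open>norm (z - y)\<close> of \<open>y\<close>.\<close>

lemma slater_error_bound:
  fixes f :: "nat \<Rightarrow> 'a::real_normed_vector \<Rightarrow> real"
  assumes conv: "\<And>i. i \<in> {1..m} \<Longrightarrow> convex_on UNIV (f i)"
    and "r > 0" and z: "\<And>i. i \<in> {1..m} \<Longrightarrow> f i z + e \<le> - r"
    and "M \<ge> 0" and y: "\<And>i. i \<in> {1..m} \<Longrightarrow> f i y + e \<le> M"
  shows "infdist y (perturbed_set m f e) \<le> M / r * norm (z - y)"
proof -
  define t where "t = M / (M + r)"
  have t: "0 \<le> t" "t \<le> 1" "t \<le> M / r" "(1 - t) * M + t * (- r) = 0"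
    using \<open>r > 0\<close> \<open>M \<ge> 0\<close> by (auto simp: t_def field_simps)
  define s where "s = (1 - t) *\<^sub>R y + t *\<^sub>R z"
  have "f i s + e \<le> 0" if i: "i \<in> {1..m}" for i
  proof -
    have "f i s \<le> (1 - t) * f i y + t * f i z"
      unfolding s_def using convex_onD[OF conv[OF i], of t y z] t by simp
    then have "f i s + e \<le> (1 - t) * (f i y + e) + t * (f i z + e)"
      by (simp add: algebra_simps)
    also have "\<dots> \<le> (1 - t) * M + t * (- r)"
      using t y[OF i] z[OF i] by (intro add_mono mult_left_mono) auto
    finally show ?thesis using t by simp
  qed
  then have "infdist y (perturbed_set m f e) \<le> dist y s"
    by (intro infdist_le) (simp add: perturbed_set_def)
  also have "\<dots> = t * norm (z - y)"
  proof -
    have "s - y = t *\<^sub>R (z - y)" by (simp add: s_def algebra_simps)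
    then show ?thesis using t by (simp add: dist_norm norm_minus_commute)
  qed
  also have "\<dots> \<le> M / r * norm (z - y)"
    using t by (intro mult_right_mono) auto
  finally show ?thesis .
qed

text \<open>Testing the subgradient inequality at distance \<open>1\<close> in the direction of \<open>u\<close> bounds \<open>norm u\<close>
  by the oscillation of \<open>g\<close> on a slightly larger ball.\<close>

lemma subdifferential_bounded_on_cball:
  fixes g :: "'a::euclidean_space \<Rightarrow> real"
  assumes "continuous_on UNIV g"
  obtains L where "\<And>x u. x \<in> cball z R \<Longrightarrow> u \<in> subdifferential g x \<Longrightarrow> norm u \<le> L"
proof -
  have "compact (g ` cball z (R + 1))"
    using assms by (intro compact_continuous_image) (auto intro: continuous_on_subset)
  then obtain B where B: "\<And>y. y \<in> cball z (R + 1) \<Longrightarrow> \<bar>g y\<bar> \<le> B"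
    by (meson compact_imp_bounded bounded_real imageI)
  have "norm u \<le> 2 * B" if x: "x \<in> cball z R" and u: "u \<in> subdifferential g x" for x u
  proof -
    have "x + sgn u \<in> cball z (R + 1)"
      using x norm_triangle_ineq4[of "z - x" "sgn u"]
      by (simp add: dist_norm norm_sgn diff_diff_eq split: if_splits)
    moreover have "x \<in> cball z (R + 1)" using x by simp
    ultimately have "\<bar>g (x + sgn u)\<bar> \<le> B" "\<bar>g x\<bar> \<le> B" using B by blast+
    moreover have "g x + u \<bullet> (x + sgn u - x) \<le> g (x + sgn u)"
      using u unfolding subdifferential_def by blast
    moreover have "u \<bullet> sgn u = norm u"
      by (cases "u = 0") (auto simp: sgn_div_norm power2_eq_square field_simps
          simp flip: power2_norm_eq_inner)
    ultimately show ?thesis by simp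
  qed
  then show thesis by (rule that)
qed

text \<open>The largest violation \<open>M\<close> at \<open>x\<close> equals \<open>norm (v i) * norm (u i)\<close> for the index \<open>i\<close> that
  attains it, so the error bound controls the distance to the perturbed set by \<open>sqrt Q\<close>, and
  the decrease by \<open>Q\<close> of the squared distance is a decrease by a fixed proportion.\<close>

lemma infdist_paca_next_contracts:
  fixes f :: "nat \<Rightarrow> 'a::euclidean_space \<Rightarrow> real"
  assumes conv: "\<And>i. i \<in> {1..m} \<Longrightarrow> convex_on UNIV (f i)"
    and u: "\<And>i. i \<in> {1..m} \<Longrightarrow> u i \<in> subdifferential (f i) x"
    and u_nz: "\<And>i. i \<in> {1..m} \<Longrightarrow> f i x + e > 0 \<Longrightarrow> u i \<noteq> 0"
    and L: "\<And>i. i \<in> {1..m} \<Longrightarrow> norm (u i) \<le> L"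
    and "r > 0" and z: "\<And>i. i \<in> {1..m} \<Longrightarrow> f i z + e \<le> - r"
    and R: "norm (z - x) \<le> R"
    and viol: "x \<notin> perturbed_set m f e"
    and N: "N \<ge> 1" "real m * (L * R / r)\<^sup>2 \<le> N"
  shows "(infdist (paca_next m f e x u) (perturbed_set m f e))\<^sup>2
    \<le> (1 - 1 / N) * (infdist x (perturbed_set m f e))\<^sup>2"
proof -
  let ?D = "perturbed_set m f e"
  define Q where "Q = paca_mean_sq m f e x u"
  have "Q \<ge> 0" unfolding Q_def by (rule paca_mean_sq_nonneg)
  define M where "M = Max ((\<lambda>i. f i x + e) ` {1..m})"
  obtain j where j: "j \<in> {1..m}" "f j x + e > 0"
    using viol by (auto simp: perturbed_set_def not_le)
  have M_ge: "f i x + e \<le> M" if "i \<in> {1..m}" for i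
    unfolding M_def using that by (intro Max_ge) auto
  have "M > 0" using M_ge[OF j(1)] j(2) by linarith
  have "M \<in> (\<lambda>i. f i x + e) ` {1..m}"
    unfolding M_def using j(1) by (intro Max_in) auto
  then obtain i where i: "i \<in> {1..m}" "M = f i x + e" by auto
  have "M = norm (paca_v f e x u i) * norm (u i)"
    using u_nz[OF i(1)] i(2) \<open>M > 0\<close> by (simp add: paca_v_def power2_eq_square)
  also have "\<dots> \<le> norm (paca_v f e x u i) * L"
    using L[OF i(1)] by (intro mult_left_mono) auto
  finally have M_le: "M \<le> norm (paca_v f e x u i) * L" .
  have "infdist x ?D \<le> M / r * norm (z - x)"
    using conv \<open>r > 0\<close> z \<open>M > 0\<close> M_ge by (intro slater_error_bound) auto
  also have "\<dots> \<le> (norm (paca_v f e x u i) * L) / r * R"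
    using M_le R \<open>r > 0\<close> \<open>M > 0\<close> by (intro mult_mono divide_right_mono) auto
  finally have "infdist x ?D \<le> norm (paca_v f e x u i) * (L * R / r)" by simp
  then have "(infdist x ?D)\<^sup>2 \<le> (norm (paca_v f e x u i) * (L * R / r))\<^sup>2"
    by (intro power_mono infdist_nonneg)
  also have "\<dots> \<le> (real m * Q) * (L * R / r)\<^sup>2"
    unfolding power_mult_distrib Q_def
    using norm_paca_v_le_mean_sq[OF i(1)] by (intro mult_right_mono) auto
  also have "\<dots> \<le> N * Q"
    using mult_right_mono[OF N(2) \<open>Q \<ge> 0\<close>] by (simp add: mult_ac)
  finally have Q_ge: "(infdist x ?D)\<^sup>2 / N \<le> Q"
    using N(1) by (simp add: field_simps)
  have "closed ?D"
    using conv by (intro closed_perturbed_set convex_on_continuous) auto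
  moreover have "z \<in> ?D" using z \<open>r > 0\<close> by (force simp: perturbed_set_def)
  ultimately obtain s where s: "s \<in> ?D" "infdist x ?D = dist x s"
    using infdist_attains_inf[of ?D x] by blast
  have "(infdist (paca_next m f e x u) ?D)\<^sup>2 \<le> (dist (paca_next m f e x u) s)\<^sup>2"
    using s by (intro power_mono infdist_le infdist_nonneg)
  also have "\<dots> \<le> (infdist x ?D)\<^sup>2 - Q"
    using paca_next_fejer[OF u s(1)] by (simp add: s(2) dist_norm Q_def)
  finally show ?thesis using Q_ge by (simp add: algebra_simps)
qed

section \<open>Convergence from geometric decay of the distance\<close>

text \<open>The point of \<open>D k\<close> nearest to \<open>x k\<close> is at distance \<open>infdist (x k) (D k)\<close> from \<open>x k\<close> and no
  farther from any later iterate, so the tail of the sequence has diameter at most twice that.\<close>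

lemma fejer_geometric_convergence:
  fixes x :: "nat \<Rightarrow> 'a::euclidean_space" and D :: "nat \<Rightarrow> 'a set"
  assumes D: "\<And>k. closed (D k)" "\<And>k. D k \<noteq> {}" "\<And>k. D k \<subseteq> D (Suc k)"
    and fejer: "\<And>k s. s \<in> D k \<Longrightarrow> norm (x (Suc k) - s) \<le> norm (x k - s)"
    and decay: "\<And>k. infdist (x k) (D k) \<le> A * q ^ k"
    and q: "0 \<le> q" "q < 1"
    and E: "closed E" "\<And>k. D k \<subseteq> E"
  shows "\<exists>l\<in>E. \<forall>k. norm (x k - l) \<le> 2 * A * q ^ k"
proof -
  have mono: "D k \<subseteq> D n" if "k \<le> n" for k n
    using lift_Suc_mono_le[of D, OF D(3) that] .
  have tail: "norm (x k - x n) \<le> 2 * A * q ^ k" if "k \<le> n" for k n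
  proof -
    obtain s where s: "s \<in> D k" "infdist (x k) (D k) = dist (x k) s"
      using infdist_attains_inf[OF D(1,2)] by blast
    have "norm (x n - s) \<le> norm (x k - s)"
      using that
    proof (induction n rule: dec_induct)
      case (step n)
      have "s \<in> D n" using mono[OF step(1)] s(1) by auto
      then show ?case using fejer[of s n] step by linarith
    qed simp
    moreover have "norm (x k - s) \<le> A * q ^ k"
      using decay[of k] s(2) by (simp add: dist_norm)
    ultimately show ?thesis
      using norm_triangle_ineq4[of "x k - s" "x n - s"] by simp
  qed
  have "(\<lambda>k. 2 * A * q ^ k) \<longlonglongrightarrow> 2 * A * 0"
    using q by (intro tendsto_intros LIMSEQ_power_zero) auto
  then have to0: "(\<lambda>k. 2 * A * q ^ k) \<longlonglongrightarrow> 0" by simp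
  have "Cauchy x"
  proof (rule CauchyI')
    fix e :: real assume "e > 0"
    then have "\<forall>\<^sub>F k in sequentially. 2 * A * q ^ k < e"
      using order_tendstoD(2)[OF to0] by blast
    then obtain M where M: "\<And>k. k \<ge> M \<Longrightarrow> 2 * A * q ^ k < e"
      by (auto simp: eventually_sequentially)
    have "dist (x k) (x n) < e" if "M \<le> k" "k < n" for k n
      using tail[of k n] M[of k] that by (simp add: dist_norm)
    then show "\<exists>M. \<forall>k\<ge>M. \<forall>n>k. dist (x k) (x n) < e" by blast
  qed
  then obtain l where l: "x \<longlonglongrightarrow> l"
    using Cauchy_convergent convergent_def by blast
  have bound: "norm (x k - l) \<le> 2 * A * q ^ k" for k
  proof (rule Lim_bounded)
    show "(\<lambda>n. norm (x k - x n)) \<longlonglongrightarrow> norm (x k - l)"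
      by (intro tendsto_intros l)
    show "\<forall>n\<ge>k. norm (x k - x n) \<le> 2 * A * q ^ k" using tail by blast
  qed
  have "(\<lambda>k. infdist (x k) E) \<longlonglongrightarrow> 0"
  proof (rule tendsto_sandwich)
    show "\<forall>\<^sub>F k in sequentially. 0 \<le> infdist (x k) E" by (simp add: infdist_nonneg)
    have "infdist (x k) E \<le> 2 * A * q ^ k" for k
    proof -
      have "infdist (x k) E \<le> infdist (x k) (D k)"
        using infdist_mono[OF E(2) D(2)] .
      then show ?thesis using decay[of k] infdist_nonneg[of "x k" "D k"] by linarith
    qed
    then show "\<forall>\<^sub>F k in sequentially. infdist (x k) E \<le> 2 * A * q ^ k" by simp
  qed (use to0 in auto)
  moreover have "(\<lambda>k. infdist (x k) E) \<longlonglongrightarrow> infdist l E"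
    by (intro tendsto_infdist l)
  ultimately have "infdist l E = 0" using LIMSEQ_unique by blast
  moreover have "E \<noteq> {}" using D(2) E(2) by blast
  ultimately have "l \<in> E" using in_closed_iff_infdist_zero[OF E(1)] by blast
  then show ?thesis using bound by blast
qed

lemma R_linearly_converges_if_geometric_bound:
  assumes bound: "\<And>k. k \<ge> K \<Longrightarrow> norm (y k - l) \<le> A * q ^ k"
    and "A > 0" "0 \<le> q" "q < 1"
  shows "R_linearly_converges y l"
proof -
  have "(\<lambda>k. ereal (root k A * q)) \<longlonglongrightarrow> ereal (1 * q)"
    using \<open>A > 0\<close> by (intro tendsto_intros LIMSEQ_root_const)
  then have lim: "limsup (\<lambda>k. ereal (root k A * q)) = ereal q"
    by (simp add: lim_imp_Limsup)
  have "\<forall>\<^sub>F k in sequentially. ereal (root k (norm (y k - l))) \<le> ereal (root k A * q)"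
    using eventually_ge_at_top[of "max 1 K"]
  proof eventually_elim
    case (elim k)
    then have "root k (norm (y k - l)) \<le> root k (A * q ^ k)"
      using bound by (intro real_root_le_mono) auto
    also have "\<dots> = root k A * q"
      using elim \<open>0 \<le> q\<close> by (simp add: real_root_mult real_root_power_cancel)
    finally show ?case by simp
  qed
  then have "limsup (\<lambda>k. ereal (root k (norm (y k - l)))) \<le> ereal q"
    unfolding lim[symmetric] by (rule Limsup_mono)
  also have "\<dots> < 1" using \<open>q < 1\<close> by simp
  finally show ?thesis by (simp add: R_linearly_converges_def)
qed

section \<open>Linear convergence under the Slater condition\<close>

theorem theorem5p6:
  fixes m :: nat
    and f :: "nat \<Rightarrow> real ^ 'n \<Rightarrow> real"
    and \<epsilon> :: "nat \<Rightarrow> real"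
    and x0 :: "real ^ 'n"
    and x :: "nat \<Rightarrow> real ^ 'n"
    and u :: "nat \<Rightarrow> nat \<Rightarrow> real ^ 'n"
  assumes "m \<ge> 1"
    and "\<And>i. i \<in> {1..m} \<Longrightarrow> convex_on UNIV (f i)"
    and "\<And>k. \<epsilon> k > 0"
    and "\<And>k. \<epsilon> (Suc k) < \<epsilon> k"
    and "\<epsilon> \<longlonglongrightarrow> 0"
    and "slater m f"
    and "paca_run m f \<epsilon> x0 x u"
    and "paca_infinite m f x"
  shows "\<exists>l \<in> feasible_set m f. R_linearly_converges x l"
proof -
  note conv = assms(2) and \<epsilon>_pos = assms(3)
  let ?D = "\<lambda>k. perturbed_set m f (\<epsilon> k)"
  have cont: "continuous_on UNIV (f i)" if "i \<in> {1..m}" for i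
    using conv[OF that] by (intro convex_on_continuous) auto
  have infeasible: "x k \<notin> feasible_set m f" for k
    using assms(8) by (simp add: paca_infinite_def)
  have sub: "u k i \<in> subdifferential (f i) (x k)"
    and u_nz: "f i (x k) + \<epsilon> k > 0 \<Longrightarrow> u k i \<noteq> 0" if "i \<in> {1..m}" for k i
    using assms(7) infeasible[of k] that unfolding paca_run_def by meson+
  have x_Suc: "x (Suc k) = paca_next m f (\<epsilon> k) (x k) (u k)" for k
    using assms(7) infeasible[of k] unfolding paca_run_def by meson
  have D_mono: "?D k \<subseteq> ?D (Suc k)" for k
    using assms(4)[of k] by (intro perturbed_set_antimono) simp
  have D_feasible: "?D k \<subseteq> feasible_set m f" for k
    unfolding feasible_set_eq_perturbed_set
    using \<epsilon>_pos[of k] by (intro perturbed_set_antimono) simp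
  have fejer: "norm (x (Suc k) - s) \<le> norm (x k - s)" if "s \<in> ?D k" for k s
  proof (rule power2_le_imp_le)
    show "(norm (x (Suc k) - s))\<^sup>2 \<le> (norm (x k - s))\<^sup>2"
      using paca_next_fejer[OF sub that] paca_mean_sq_nonneg[of m f "\<epsilon> k" "x k" "u k"]
      unfolding x_Suc by (smt (verit))
  qed simp

  obtain z where z: "\<And>i. i \<in> {1..m} \<Longrightarrow> f i z < 0"
    using assms(6) unfolding slater_def by blast
  \<comment> \<open>Half of the Slater margin \<open>2 * r\<close> at \<open>z\<close> is spent on the perturbation, the other half is
    the margin that the error bound needs.\<close>
  define r where "r = Min ((\<lambda>i. - f i z) ` {1..m}) / 2"
  have "r > 0" unfolding r_def using z \<open>m \<ge> 1\<close> by (simp add: Min_gr_iff)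
  have z_r: "f i z \<le> - (2 * r)" if "i \<in> {1..m}" for i
  proof -
    have "Min ((\<lambda>i. - f i z) ` {1..m}) \<le> - f i z" using that by (intro Min_le) auto
    then show ?thesis by (simp add: r_def)
  qed
  obtain K where K: "\<And>k. k \<ge> K \<Longrightarrow> \<epsilon> k < r"
    using order_tendstoD(2)[OF assms(5) \<open>r > 0\<close>] by (auto simp: eventually_sequentially)
  have z_margin: "f i z + \<epsilon> k \<le> - r" if "i \<in> {1..m}" "k \<ge> K" for i k
    using z_r[OF that(1)] K[OF that(2)] by linarith
  have z_in: "z \<in> ?D k" if "k \<ge> K" for k
    using z_margin that \<open>r > 0\<close> by (force simp: perturbed_set_def)

  define R where "R = norm (x K - z)"
  have R: "norm (z - x k) \<le> R" if "k \<ge> K" for k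
    using that
  proof (induction k rule: dec_induct)
    case (step k)
    then show ?case using fejer[OF z_in[of k]] by (simp add: norm_minus_commute)
  qed (simp add: R_def norm_minus_commute)

  have "\<exists>L. \<forall>x v. x \<in> cball z R \<longrightarrow> v \<in> subdifferential (f i) x \<longrightarrow> norm v \<le> L"
    if "i \<in> {1..m}" for i
    using subdifferential_bounded_on_cball[OF cont[OF that], of z R] by metis
  then obtain L' where L': "\<And>i x v. i \<in> {1..m} \<Longrightarrow> x \<in> cball z R \<Longrightarrow>
      v \<in> subdifferential (f i) x \<Longrightarrow> norm v \<le> L' i"
    by metis
  define L where "L = Max (L' ` {1..m})"
  have L: "norm (u k i) \<le> L" if "i \<in> {1..m}" "k \<ge> K" for k i
  proof -
    have "norm (u k i) \<le> L' i"
      using R[OF that(2)] sub[OF that(1)] by (intro L'[OF that(1)]) (auto simp: dist_norm)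
    also have "\<dots> \<le> L" unfolding L_def using that(1) by (intro Max_ge) auto
    finally show ?thesis .
  qed

  \<comment> \<open>The lower bound \<open>2\<close> keeps \<open>q\<close> positive, so that the shift of the index by \<open>K\<close> can be
    absorbed into the constant at the end.\<close>
  define N where "N = max 2 (real m * (L * R / r)\<^sup>2)"
  define q where "q = sqrt (1 - 1 / N)"
  have "N \<ge> 2" by (simp add: N_def)
  then have "N \<ge> 1" "q > 0" and q: "0 \<le> q" "q < 1" and q_sq: "q\<^sup>2 = 1 - 1 / N"
    by (auto simp: q_def)
  have contract: "infdist (x (Suc k)) (?D (Suc k)) \<le> q * infdist (x k) (?D k)"
    if "k \<ge> K" for k
  proof -
    have "(infdist (x (Suc k)) (?D k))\<^sup>2 \<le> (1 - 1 / N) * (infdist (x k) (?D k))\<^sup>2"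
      unfolding x_Suc
    proof (rule infdist_paca_next_contracts[OF conv sub u_nz L[OF _ that] \<open>r > 0\<close>
          z_margin[OF _ that] R[OF that] _ \<open>N \<ge> 1\<close>])
      show "x k \<notin> ?D k" using infeasible[of k] D_feasible[of k] by blast
    qed (auto simp: N_def)
    also have "\<dots> = (q * infdist (x k) (?D k))\<^sup>2"
      by (simp add: power_mult_distrib q_sq)
    finally have "infdist (x (Suc k)) (?D k) \<le> q * infdist (x k) (?D k)"
      by (rule power2_le_imp_le) (simp add: infdist_nonneg q)
    moreover have "infdist (x (Suc k)) (?D (Suc k)) \<le> infdist (x (Suc k)) (?D k)"
      using D_mono z_in[OF that] by (intro infdist_mono) auto
    ultimately show ?thesis by linarith
  qed

  define A where "A = infdist (x K) (?D K) + 1"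
  have "A > 0" using infdist_nonneg[of "x K" "?D K"] by (simp add: A_def)
  have decay: "infdist (x (K + k)) (?D (K + k)) \<le> A * q ^ k" for k
  proof (induction k)
    case 0
    then show ?case by (simp add: A_def)
  next
    case (Suc k)
    have "infdist (x (K + Suc k)) (?D (K + Suc k)) \<le> q * infdist (x (K + k)) (?D (K + k))"
      using contract[of "K + k"] by simp
    also have "\<dots> \<le> q * (A * q ^ k)" using Suc q by (intro mult_left_mono)
    finally show ?case by (simp add: mult_ac)
  qed
  have "\<exists>l\<in>feasible_set m f. \<forall>k. norm (x (K + k) - l) \<le> 2 * A * q ^ k"
  proof (rule fejer_geometric_convergence[where D = "\<lambda>k. ?D (K + k)"])
    show "?D (K + k) \<noteq> {}" for k using z_in[of "K + k"] by auto
    show "closed (feasible_set m f)"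
      unfolding feasible_set_eq_perturbed_set by (intro closed_perturbed_set cont)
  qed (use cont fejer decay q D_mono D_feasible in \<open>auto intro!: closed_perturbed_set\<close>)
  then obtain l where l: "l \<in> feasible_set m f"
    and bound: "\<And>k. norm (x (K + k) - l) \<le> 2 * A * q ^ k" by blast
  have "R_linearly_converges x l"
  proof (rule R_linearly_converges_if_geometric_bound)
    show "norm (x k - l) \<le> 2 * A / q ^ K * q ^ k" if "k \<ge> K" for k
      using bound[of "k - K"] that \<open>q > 0\<close> by (simp add: power_diff)
  qed (use \<open>A > 0\<close> \<open>q > 0\<close> \<open>q < 1\<close> in auto)
  then show ?thesis using l by blast
qed

end
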